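(* Let $\mathbb{T}$ be a time scale, let $a,b\in\mathbb{T}$ with $a<b$, and put $I_{\mathbb{T}}:=[a,b]_{\mathbb{T}}$. Let $f\in C_{rd}(I_{\mathbb{T}},\mathbb{R})$ and $k\in C_{rd}(I_{\mathbb{T}}\times I_{\mathbb{T}},\mathbb{R})$. Then the integral equation $$x(t)=f(t)+\int_a^t k(t,s)\,x(s)\,\Delta s,\qquad t\in I_{\mathbb{T}},$$ has Hyers-Ulam stability on $I_{\mathbb{T}}$. That is, there is a constant $C\ge 0$ such that for every $\varepsilon>0$ and every $\psi\in C_{rd}(I_{\mathbb{T}},\mathbb{R})$ satisfying $$\Big|\psi(t)-f(t)-\int_a^t k(t,s)\,\psi(s)\,\Delta s\Big|<\varepsilon\qquad\text{for all } t\in I_{\mathbb{T}},$$ there exists a solution $\varphi\in C_{rd}(I_{\mathbb{T}},\mathbb{R})$ of the integral equation with $$|\varphi(t)-\psi(t)|\le C\,\varepsilon\qquad\text{for all } t\in I_{\mathbb{T}}.$$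
   Context: A time scale $\mathbb{T}$ is a nonempty closed subset of $\mathbb{R}$, and $[a,b]_{\mathbb{T}}:=[a,b]\cap\mathbb{T}$. The forward jump operator is $\sigma(t):=\inf\{s\in\mathbb{T}:s>t\}$ (with $\sigma(\max\mathbb{T})=\max\mathbb{T}$ if the maximum exists). The backward jump operator is $\rho(t):=\sup\{s\in\mathbb{T}:s<t\}$ (with $\rho(\min\mathbb{T})=\min\mathbb{T}$ if the minimum exists). A point $t$ is right-scattered if $\sigma(t)>t$, right-dense if $t<\sup\mathbb{T}$ and $\sigma(t)=t$, and left-dense if $t>\inf\mathbb{T}$ and $\rho(t)=t$. On $I_{\mathbb{T}}=[a,b]_{\mathbb{T}}$ these notions are taken relative to the time scale $I_{\mathbb{T}}$. A function $g:I_{\mathbb{T}}\to\mathbb{R}$ is rd-continuous, written $g\in C_{rd}(I_{\mathbb{T}},\mathbb{R})$, if it is continuous at right-dense points and has finite left-sided limits at left-dense points. The integral $\int_a^t g(s)\,\Delta s$ is the delta (Hilger) integral on $\mathbb{T}$: for rd-continuous $g$ it equals $G(t)-G(a)$, where $G$ is a delta-antiderivative of $g$. Rd-continuity in two variables, $k\in C_{rd}(I_{\mathbb{T}}\times I_{\mathbb{T}},\mathbb{R})$, means the following. For $t_0\in I_{\mathbb{T}}$ let $\mathcal{A}(t_0)=\{I_{\mathbb{T}}\}$ if $t_0$ is right-dense, and $\mathcal{A}(t_0)=\{\{t_0\},\{t\in I_{\mathbb{T}}:t<t_0\}\}$ otherwise. For every $(t_0,s_0)$ and all $A\in\mathcal{A}(t_0)$,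 $B\in\mathcal{A}(s_0)$ such that $(t_0,s_0)$ lies in the closure of $A\times B$, the function $k(t,s)$ has a finite limit as $(t,s)\to(t_0,s_0)$ with $(t,s)\in A\times B$, and this limit equals $k(t_0,s_0)$ if $(t_0,s_0)\in A\times B$. A solution of the integral equation is a function satisfying it for all $t\in I_{\mathbb{T}}$. *)

theory Defs
  imports "HOL-Analysis.Analysis"
begin

definition time_scale :: "real set \<Rightarrow> bool" where
  "time_scale T \<longleftrightarrow> T \<noteq> {} \<and> closed T"

definition ts_interval :: "real set \<Rightarrow> real \<Rightarrow> real \<Rightarrow> real set" where
  "ts_interval T a b = {a..b} \<inter> T"

definition fwd_jump :: "real set \<Rightarrow> real \<Rightarrow> real" where
  "fwd_jump T t = (if \<exists>s\<in>T. t < s then Inf {s\<in>T. t < s} else t)"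

definition bwd_jump :: "real set \<Rightarrow> real \<Rightarrow> real" where
  "bwd_jump T t = (if \<exists>s\<in>T. s < t then Sup {s\<in>T. s < t} else t)"

text \<open>
  The existence conditions below say that \<open>t\<close> is strictly below the supremum, respectively strictly
  above the infimum, of \<open>T\<close> in the extended reals; \<^const>\<open>Sup\<close> and \<^const>\<open>Inf\<close> on
  \<^typ>\<open>real\<close> are unspecified on unbounded sets.
\<close>

definition right_dense :: "real set \<Rightarrow> real \<Rightarrow> bool" where
  "right_dense T t \<longleftrightarrow> (\<exists>s\<in>T. t < s) \<and> fwd_jump T t = t"

definition left_dense :: "real set \<Rightarrow> real \<Rightarrow> bool" where
  "left_dense T t \<longleftrightarrow> (\<exists>s\<in>T. s < t) \<and> bwd_jump T t = t"

text \<open>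
  Functions on a time scale are total functions on \<^typ>\<open>real\<close>; only their values on the time
  scale matter in the following notions.
\<close>

definition rd_continuous :: "real set \<Rightarrow> (real \<Rightarrow> real) \<Rightarrow> bool" where
  "rd_continuous T g \<longleftrightarrow>
     (\<forall>t\<in>T. (right_dense T t \<longrightarrow> continuous (at t within T) g) \<and>
            (left_dense T t \<longrightarrow> (\<exists>l. (g \<longlongrightarrow> l) (at t within (T \<inter> {..<t})))))"

definition rd_pieces :: "real set \<Rightarrow> real \<Rightarrow> real set set" where
  "rd_pieces T t = (if right_dense T t then {T} else {{t}, {s\<in>T. s < t}})"

text \<open>
  The filter \<open>at p within S\<close> is punctured. This is harmless: if \<open>p \<in> S\<close>, the limit is required to be
  the value at \<open>p\<close> anyway, and if \<open>p\<close> is isolated in \<open>S\<close>, that value is an admissible limit.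
\<close>

definition rd_continuous2 :: "real set \<Rightarrow> (real \<Rightarrow> real \<Rightarrow> real) \<Rightarrow> bool" where
  "rd_continuous2 T k \<longleftrightarrow>
     (\<forall>t\<in>T. \<forall>s\<in>T. \<forall>A\<in>rd_pieces T t. \<forall>B\<in>rd_pieces T s. (t, s) \<in> closure (A \<times> B) \<longrightarrow>
        (\<exists>l. ((\<lambda>(u, v). k u v) \<longlongrightarrow> l) (at (t, s) within (A \<times> B)) \<and>
             ((t, s) \<in> A \<times> B \<longrightarrow> l = k t s)))"

definition has_delta_derivative ::
    "real set \<Rightarrow> (real \<Rightarrow> real) \<Rightarrow> real \<Rightarrow> real \<Rightarrow> bool" where
  "has_delta_derivative T G D t \<longleftrightarrow>
     (\<forall>e>0. \<exists>d>0. \<forall>s\<in>T. \<bar>s - t\<bar> < d \<longrightarrow>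
        \<bar>G (fwd_jump T t) - G s - D * (fwd_jump T t - s)\<bar> \<le> e * \<bar>fwd_jump T t - s\<bar>)"

text \<open>
  The derivative is prescribed everywhere except at a possible maximum of \<open>T\<close>. At a left-scattered
  maximum the delta derivative is not defined. At a left-dense maximum an rd-continuous function may
  jump, since such a point is not right-dense, so that \<open>G\<close> can only be required to be continuous
  there. If \<open>G\<close> does have the prescribed derivative at a left-dense maximum as well, continuity there
  is automatic.
\<close>

definition delta_antiderivative :: "real set \<Rightarrow> (real \<Rightarrow> real) \<Rightarrow> (real \<Rightarrow> real) \<Rightarrow> bool" where
  "delta_antiderivative T g G \<longleftrightarrow>
     continuous_on T G \<and> (\<forall>t\<in>T. (\<exists>s\<in>T. t < s) \<longrightarrow> has_delta_derivative T G (g t) t)"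

definition delta_integral :: "real set \<Rightarrow> (real \<Rightarrow> real) \<Rightarrow> real \<Rightarrow> real \<Rightarrow> real" where
  "delta_integral T g a t = (THE J. \<exists>G. delta_antiderivative T g G \<and> J = G t - G a)"

end

theory Submission
  imports Defs
begin

text \<open>
  The time scale interval \<open>I\<close> is embedded into the real interval \<open>{a..b}\<close>: a function \<open>g\<close> on \<open>I\<close> is
  extended by the value at the last point of \<open>I\<close> passed so far, that is, to \<open>g \<circ> tfloor\<close>, which is
  constant on every gap of \<open>I\<close>. The ordinary integral of this extension, evaluated at points of \<open>I\<close>,
  is a delta antiderivative of \<open>g\<close>: across a gap it increases by the length of the gap times the value
  of \<open>g\<close> at the left end, and at right-dense points the usual argument of the fundamental theorem of calculus applies. Delta
  antiderivatives are unique up to a constant, so the delta integral is this ordinary integral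
  (\<open>delta_integral_eq_step_integral\<close>), and dominated convergence becomes available.

  The integral equation is then \<open>x = f + V x\<close> with a Volterra operator \<open>V\<close> whose kernel is bounded, say
  by \<open>K\<close>. Given an approximate solution \<open>\<psi>\<close> with residual \<open>r = \<psi> - f - V \<psi>\<close>, \<open>\<bar>r\<bar> \<le> \<epsilon>\<close>, let \<open>e\<close> be
  the Neumann series \<open>\<Sum>n. V\<^sup>n r\<close>. It satisfies \<open>e = r + V e\<close> (\<open>neumann_fixpoint\<close>), so that \<open>\<phi> = \<psi> - e\<close>
  is an exact solution. Iterating the estimate for \<open>V\<close> gives \<open>\<bar>V\<^sup>n r\<bar> \<le> \<epsilon> (K (t - a))\<^sup>n / n!\<close>, hence
  \<open>\<bar>\<phi> - \<psi>\<bar> \<le> exp (K (b - a)) \<epsilon>\<close>, and the constant \<open>exp (K (b - a))\<close> depends only on the kernel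
  and the interval.

  Rd-continuity of \<open>\<phi>\<close> comes from a smoothing property: \<open>V\<close> maps every bounded function whose extension
  is Borel measurable to an rd-continuous function (\<open>rd_continuous_volterra\<close>). It therefore suffices
  to know that the Neumann series is bounded and Borel measurable, and both properties pass to it from
  its partial sums by pointwise convergence.
\<close>

section \<open>Local boundedness and slices of limits\<close>

lemma compact_locally_bounded_imp_bounded:
  fixes f :: "'x::topological_space \<Rightarrow> real"
  assumes "compact S" and loc: "\<And>p. p \<in> S \<Longrightarrow> \<exists>M. \<forall>\<^sub>F x in at p within S. \<bar>f x\<bar> \<le> M"
  shows "\<exists>M. \<forall>x\<in>S. \<bar>f x\<bar> \<le> M"
proof -
  have "\<exists>U M. open U \<and> p \<in> U \<and> (\<forall>x\<in>S \<inter> U. \<bar>f x\<bar> \<le> M)" if "p \<in> S" for p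
  proof -
    from loc[OF that] obtain M U where "open U" "p \<in> U" "\<forall>x\<in>U. x \<noteq> p \<longrightarrow> x \<in> S \<longrightarrow> \<bar>f x\<bar> \<le> M"
      by (auto simp: eventually_at_topological)
    then have "\<forall>x\<in>S \<inter> U. \<bar>f x\<bar> \<le> max M \<bar>f p\<bar>" by fastforce
    with \<open>open U\<close> \<open>p \<in> U\<close> show ?thesis by blast
  qed
  then obtain U M where U: "\<And>p. p \<in> S \<Longrightarrow> open (U p) \<and> p \<in> U p \<and> (\<forall>x\<in>S \<inter> U p. \<bar>f x\<bar> \<le> M p)"
    by metis
  obtain D where D: "D \<subseteq> S" "finite D" "S \<subseteq> (\<Union>p\<in>D. U p)"
    using compactE_image[OF \<open>compact S\<close>, of S U] U by blast
  have "\<bar>f x\<bar> \<le> (\<Sum>p\<in>D. \<bar>M p\<bar>)" if x: "x \<in> S" for x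
  proof -
    obtain p where p: "p \<in> D" "x \<in> U p" using D(3) x by auto
    then have "\<bar>f x\<bar> \<le> M p" using U[of p] D(1) x by blast
    also have "\<dots> \<le> \<bar>M p\<bar>" by simp
    also have "\<dots> \<le> (\<Sum>p\<in>D. \<bar>M p\<bar>)" using D p by (intro member_le_sum) auto
    finally show ?thesis .
  qed
  then show ?thesis by blast
qed

lemma eventually_bounded_Union:
  fixes f :: "'x::topological_space \<Rightarrow> real"
  assumes "finite \<P>" and "\<And>P. P \<in> \<P> \<Longrightarrow> \<exists>M. \<forall>\<^sub>F x in at p within P. \<bar>f x\<bar> \<le> M"
  shows "\<exists>M. \<forall>\<^sub>F x in at p within \<Union>\<P>. \<bar>f x\<bar> \<le> M"
  using assms
proof (induction \<P> rule: finite_induct)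
  case (insert P \<P>)
  then obtain M N where "\<forall>\<^sub>F x in at p within P. \<bar>f x\<bar> \<le> M" "\<forall>\<^sub>F x in at p within \<Union>\<P>. \<bar>f x\<bar> \<le> N"
    by blast
  then have "\<forall>\<^sub>F x in at p within P. \<bar>f x\<bar> \<le> max M N" "\<forall>\<^sub>F x in at p within \<Union>\<P>. \<bar>f x\<bar> \<le> max M N"
    by (auto elim: eventually_mono)
  then show ?case by (auto simp: at_within_union eventually_sup)
qed simp

lemma tendsto_imp_eventually_bounded:
  fixes f :: "'x \<Rightarrow> real"
  assumes "(f \<longlongrightarrow> l) F" shows "\<exists>M. \<forall>\<^sub>F x in F. \<bar>f x\<bar> \<le> M"
proof
  have "\<forall>\<^sub>F x in F. dist (f x) l < 1" using assms by (rule tendstoD) simp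
  then show "\<forall>\<^sub>F x in F. \<bar>f x\<bar> \<le> \<bar>l\<bar> + 1" by eventually_elim (auto simp: dist_real_def)
qed

lemma tendsto_section:
  fixes F :: "'x::topological_space \<times> 'y::topological_space \<Rightarrow> 'z::topological_space"
  assumes "(F \<longlongrightarrow> l) (at (t, s) within A \<times> B)" "s \<in> B"
  shows "((\<lambda>u. F (u, s)) \<longlongrightarrow> l) (at t within A)"
proof (rule filterlim_compose[OF assms(1)])
  show "filterlim (\<lambda>u. (u, s)) (at (t, s) within A \<times> B) (at t within A)"
    unfolding filterlim_at using assms(2)
    by (auto intro!: tendsto_intros simp: eventually_at_filter)
qed

section \<open>Compact time scales\<close>

text \<open>
  Jumps and density are taken relative to the interval, so the ambient time scale can be forgotten and
  \<open>I\<close> serves as a time scale in its own right.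
\<close>

locale compact_time_scale =
  fixes I :: "real set" and a b :: real
  assumes closed_I: "closed I" and I_subset: "I \<subseteq> {a..b}"
    and a_in: "a \<in> I" and b_in: "b \<in> I"
begin

lemma compact_I: "compact I"
  using closed_I I_subset compact_Icc[of a b] closed_Int_compact[of I "{a..b}"]
  by (simp add: Int_absorb2)

lemma I_bounds: "t \<in> I \<Longrightarrow> a \<le> t" "t \<in> I \<Longrightarrow> t \<le> b"
  using I_subset by auto

lemma fwd_jump_in:
  assumes "t \<in> I" shows "fwd_jump I t \<in> I"
proof (cases "\<exists>s\<in>I. t < s")
  case True
  let ?S = "{s\<in>I. t < s}"
  have "bdd_below ?S" by (rule bdd_belowI[of _ t]) auto
  then have "Inf ?S \<in> closure ?S" using True by (intro closure_contains_Inf) auto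
  also have "\<dots> \<subseteq> I" by (rule closure_minimal) (auto simp: closed_I)
  finally show ?thesis using True by (simp add: fwd_jump_def)
qed (use assms in \<open>auto simp: fwd_jump_def\<close>)

lemma fwd_jump_ge: "t \<le> fwd_jump I t"
  by (auto simp: fwd_jump_def intro!: cInf_greatest)

lemma fwd_jump_le:
  assumes "s \<in> I" "t < s" shows "fwd_jump I t \<le> s"
proof -
  have "bdd_below {s\<in>I. t < s}" by (rule bdd_belowI[of _ t]) auto
  then show ?thesis using assms by (auto simp: fwd_jump_def intro!: cInf_lower)
qed

lemma right_dense_iff: "right_dense I t \<longleftrightarrow> (\<forall>e>0. \<exists>s\<in>I. t < s \<and> s < t + e)"
proof
  assume r: "right_dense I t"
  show "\<forall>e>0. \<exists>s\<in>I. t < s \<and> s < t + e"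
  proof (rule ccontr)
    assume "\<not> ?thesis"
    then obtain e where e: "e > 0" "\<And>s. s \<in> I \<Longrightarrow> t < s \<Longrightarrow> t + e \<le> s" by force
    with r have "t + e \<le> Inf {s\<in>I. t < s}" by (intro cInf_greatest) (auto simp: right_dense_def)
    with r e show False by (auto simp: right_dense_def fwd_jump_def split: if_splits)
  qed
next
  assume d: "\<forall>e>0. \<exists>s\<in>I. t < s \<and> s < t + e"
  then have ex: "\<exists>s\<in>I. t < s" by (meson zero_less_one)
  moreover have "fwd_jump I t \<le> t"
  proof (rule field_le_epsilon)
    fix e :: real assume "e > 0"
    with d obtain s where "s \<in> I" "t < s" "s < t + e" by blast
    then show "fwd_jump I t \<le> t + e" using fwd_jump_le[of s t] by simp
  qed
  ultimately show "right_dense I t" using fwd_jump_ge[of t] by (auto simp: right_dense_def)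
qed

text \<open>
  Left-density at \<open>t\<close> says exactly that the piece \<open>{s\<in>I. s < t}\<close> of \<^const>\<open>rd_pieces\<close> has \<open>t\<close> in its
  closure, which is the form in which rd-continuity in two variables refers to it.
\<close>

lemma left_dense_iff: "left_dense I t \<longleftrightarrow> t \<in> closure {s\<in>I. s < t}"
proof
  assume r: "left_dense I t"
  then have "Sup {s\<in>I. s < t} = t" by (auto simp: left_dense_def bwd_jump_def split: if_splits)
  moreover have "Sup {s\<in>I. s < t} \<in> closure {s\<in>I. s < t}"
    using r by (intro closure_contains_Sup bdd_aboveI[of _ t]) (auto simp: left_dense_def)
  ultimately show "t \<in> closure {s\<in>I. s < t}" by simp
next
  assume c: "t \<in> closure {s\<in>I. s < t}"
  then have "{s\<in>I. s < t} \<noteq> {}" by (metis closure_empty empty_iff)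
  then have ex: "\<exists>s\<in>I. s < t" by blast
  have bdd: "bdd_above {s\<in>I. s < t}" by (rule bdd_aboveI[of _ t]) auto
  have "t \<le> Sup {s\<in>I. s < t}"
  proof (rule field_le_epsilon)
    fix e :: real assume "e > 0"
    with c obtain s where "s \<in> I" "s < t" "dist s t < e"
      unfolding closure_approachable by blast
    then show "t \<le> Sup {s\<in>I. s < t} + e"
      using cSup_upper[OF _ bdd, of s] by (auto simp: dist_real_def)
  qed
  moreover have "Sup {s\<in>I. s < t} \<le> t" using ex by (intro cSup_least) auto
  ultimately show "left_dense I t" using ex by (auto simp: left_dense_def bwd_jump_def)
qed

lemma left_filter_bot:
  assumes "\<not> left_dense I t" shows "at t within {s\<in>I. s < t} = bot"
  using assms closure_mono[of "{s\<in>I. s < t} - {t}" "{s\<in>I. s < t}"]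
  by (auto simp: at_within_eq_bot_iff left_dense_iff)

lemma rd_piece_containing:
  assumes "t \<in> I" obtains A where "A \<in> rd_pieces I t" "t \<in> A"
  using assms by (cases "right_dense I t") (auto simp: rd_pieces_def)

text \<open>
  At a point that is not right-dense there is a gap of \<open>I\<close>, or nothing at all, to the right of \<open>t\<close>, so
  the two pieces \<open>{t}\<close> and \<open>{s\<in>I. s < t}\<close> account for all of \<open>I\<close> near \<open>t\<close>.
\<close>

lemma rd_pieces_cover:
  assumes "t \<in> I"
  obtains U where "open U" "t \<in> U" "I \<inter> U \<subseteq> \<Union>(rd_pieces I t)"
proof (cases "right_dense I t")
  case True
  then show ?thesis by (intro that[of UNIV]) (auto simp: rd_pieces_def)
next
  case False
  then obtain e where "e > 0" "\<And>s. s \<in> I \<Longrightarrow> t < s \<Longrightarrow> t + e \<le> s"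
    by (force simp: right_dense_iff)
  then show ?thesis using False
    by (intro that[of "{..<t + e}"]) (force simp: rd_pieces_def)+
qed

section \<open>Rd-continuous functions are bounded\<close>

lemma rd_continuous_piece_limit:
  assumes "rd_continuous I g" "t \<in> I" "A \<in> rd_pieces I t"
  shows "\<exists>l. (g \<longlongrightarrow> l) (at t within A)"
proof (cases "right_dense I t")
  case True
  then show ?thesis using assms by (auto simp: rd_continuous_def rd_pieces_def continuous_within)
next
  case False
  then consider "A = {t}" | "A = {s\<in>I. s < t}" using assms by (auto simp: rd_pieces_def)
  then show ?thesis
  proof cases
    case 1
    then have "at t within A = bot" by (simp add: at_within_eq_bot_iff)
    then show ?thesis by simp
  next
    case 2
    have "A = I \<inter> {..<t}" using 2 by auto
    then show ?thesis
      using assms left_filter_bot[of t] 2 by (cases "left_dense I t") (auto simp: rd_continuous_def)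
  qed
qed

lemma rd_continuous_bounded:
  assumes "rd_continuous I g" shows "\<exists>M. \<forall>t\<in>I. \<bar>g t\<bar> \<le> M"
proof (rule compact_locally_bounded_imp_bounded[OF compact_I])
  fix t assume t: "t \<in> I"
  obtain U where U: "open U" "t \<in> U" "I \<inter> U \<subseteq> \<Union>(rd_pieces I t)" using rd_pieces_cover t by blast
  have "\<exists>M. \<forall>\<^sub>F x in at t within \<Union>(rd_pieces I t). \<bar>g x\<bar> \<le> M"
    using rd_continuous_piece_limit[OF assms t] tendsto_imp_eventually_bounded
    by (intro eventually_bounded_Union) (auto simp: rd_pieces_def, blast+)
  moreover have "at t within I \<le> at t within \<Union>(rd_pieces I t)"
  proof -
    have "at t within I = at t within I \<inter> U" by (rule at_within_nhd[OF U(2,1)]) blast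
    with at_le[OF U(3), of t] show ?thesis by simp
  qed
  ultimately show "\<exists>M. \<forall>\<^sub>F x in at t within I. \<bar>g x\<bar> \<le> M" using filter_leD by blast
qed

text \<open>
  Near each point of the compact square, \<open>I \<times> I\<close> is covered by at most four products of pieces; on each
  of these the kernel has a limit, or else the product stays away from the point.
\<close>

lemma rd_continuous2_bounded:
  assumes "rd_continuous2 I k" shows "\<exists>M. \<forall>t\<in>I. \<forall>s\<in>I. \<bar>k t s\<bar> \<le> M"
proof -
  have "\<exists>M. \<forall>p\<in>I \<times> I. \<bar>(\<lambda>(u, v). k u v) p\<bar> \<le> M"
  proof (rule compact_locally_bounded_imp_bounded[OF compact_Times[OF compact_I compact_I]])
    fix p assume "p \<in> I \<times> I"
    then obtain t s where p: "p = (t, s)" "t \<in> I" "s \<in> I" by auto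
    let ?f = "\<lambda>(u, v). k u v" and ?P = "(\<lambda>(A, B). A \<times> B) ` (rd_pieces I t \<times> rd_pieces I s)"
    obtain U where U: "open U" "t \<in> U" "I \<inter> U \<subseteq> \<Union>(rd_pieces I t)" using rd_pieces_cover p by blast
    obtain V where V: "open V" "s \<in> V" "I \<inter> V \<subseteq> \<Union>(rd_pieces I s)" using rd_pieces_cover p by blast
    have "\<exists>M. \<forall>\<^sub>F x in at p within \<Union>?P. \<bar>?f x\<bar> \<le> M"
    proof (rule eventually_bounded_Union)
      fix P assume "P \<in> ?P"
      then obtain A B where P: "P = A \<times> B" "A \<in> rd_pieces I t" "B \<in> rd_pieces I s" by auto
      show "\<exists>M. \<forall>\<^sub>F x in at p within P. \<bar>?f x\<bar> \<le> M"
      proof (cases "p \<in> closure P")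
        case True
        then have "\<exists>l. (?f \<longlongrightarrow> l) (at p within P)"
          using assms P p unfolding rd_continuous2_def by blast
        then show ?thesis using tendsto_imp_eventually_bounded by blast
      next
        case False
        then have "at p within P = bot"
          using closure_mono[of "P - {p}" P] by (auto simp: at_within_eq_bot_iff)
        then show ?thesis by simp
      qed
    qed (auto simp: rd_pieces_def)
    moreover have "at p within I \<times> I \<le> at p within \<Union>?P"
    proof -
      have "(I \<times> I) \<inter> (U \<times> V) \<subseteq> \<Union>?P"
      proof
        fix q assume "q \<in> (I \<times> I) \<inter> (U \<times> V)"
        then have "fst q \<in> \<Union>(rd_pieces I t)" "snd q \<in> \<Union>(rd_pieces I s)"
          using subsetD[OF U(3), of "fst q"] subsetD[OF V(3), of "snd q"]
          by (simp_all add: mem_Times_iff)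
        then show "q \<in> \<Union>?P" by (force simp: mem_Times_iff)
      qed
      moreover have "at p within I \<times> I = at p within (I \<times> I) \<inter> (U \<times> V)"
        using U(2) V(2) p open_Times[OF U(1) V(1)] by (intro at_within_nhd[of p "U \<times> V"]) auto
      ultimately show ?thesis by (simp add: at_le)
    qed
    ultimately show "\<exists>M. \<forall>\<^sub>F x in at p within I \<times> I. \<bar>?f x\<bar> \<le> M" using filter_leD by blast
  qed
  then show ?thesis by auto
qed

lemma rd_continuous_add:
  assumes "rd_continuous I g" "rd_continuous I h" shows "rd_continuous I (\<lambda>t. g t + h t)"
  using assms unfolding rd_continuous_def by (blast intro: continuous_add tendsto_add)

lemma rd_continuous_mult:
  assumes "rd_continuous I g" "rd_continuous I h" shows "rd_continuous I (\<lambda>t. g t * h t)"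
  using assms unfolding rd_continuous_def by (blast intro: continuous_mult tendsto_mult)

section \<open>Sections of an rd-continuous kernel\<close>

text \<open>
  A joint limit over a product \<open>A \<times> B\<close> can be restricted to the line through \<open>s\<close> because some piece \<open>B\<close>
  at \<open>s\<close> contains \<open>s\<close> itself. Sections in the other variable follow by symmetry.
\<close>

lemma rd_continuous_first_section:
  assumes k: "rd_continuous2 I k" and s: "s \<in> I"
  shows "rd_continuous I (\<lambda>u. k u s)"
proof -
  obtain B where B: "B \<in> rd_pieces I s" "s \<in> B" using rd_piece_containing s by blast
  have lim: "\<exists>l. ((\<lambda>u. k u s) \<longlongrightarrow> l) (at t within A) \<and> (t \<in> A \<longrightarrow> l = k t s)"
    if t: "t \<in> I" "A \<in> rd_pieces I t" "t \<in> closure A" for t A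
  proof -
    have "(t, s) \<in> closure (A \<times> B)"
      using t B closure_subset[of B] by (auto simp: closure_Times)
    with k t s B obtain l where
      "((\<lambda>(u, v). k u v) \<longlongrightarrow> l) (at (t, s) within (A \<times> B))" "(t, s) \<in> A \<times> B \<longrightarrow> l = k t s"
      unfolding rd_continuous2_def by blast
    with tendsto_section[OF this(1) B(2)] B show ?thesis by auto
  qed
  show ?thesis
    unfolding rd_continuous_def
  proof (intro ballI conjI impI)
    fix t assume t: "t \<in> I"
    have right: "continuous (at t within I) (\<lambda>u. k u s)" if "right_dense I t"
      using lim[of t I] t that closure_subset[of I] by (auto simp: rd_pieces_def continuous_within)
    show "right_dense I t \<Longrightarrow> continuous (at t within I) (\<lambda>u. k u s)" by (rule right)
    assume ld: "left_dense I t"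
    show "\<exists>l. ((\<lambda>u. k u s) \<longlongrightarrow> l) (at t within I \<inter> {..<t})"
    proof (cases "right_dense I t")
      case True
      then show ?thesis using right tendsto_within_subset[of "\<lambda>u. k u s" _ t I "I \<inter> {..<t}"]
        by (auto simp: continuous_within)
    next
      case False
      have "I \<inter> {..<t} = {s\<in>I. s < t}" by auto
      then show ?thesis using lim[of t "{s\<in>I. s < t}"] t False ld
        by (auto simp: rd_pieces_def left_dense_iff)
    qed
  qed
qed

lemma rd_continuous2_swap:
  assumes "rd_continuous2 I k" shows "rd_continuous2 I (\<lambda>u v. k v u)"
  unfolding rd_continuous2_def
proof (intro ballI impI)
  fix t s A B
  assume *: "t \<in> I" "s \<in> I" "A \<in> rd_pieces I t" "B \<in> rd_pieces I s" "(t, s) \<in> closure (A \<times> B)"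
  then have "(s, t) \<in> closure (B \<times> A)" by (auto simp: closure_Times)
  with * assms obtain l where l: "((\<lambda>(u, v). k u v) \<longlongrightarrow> l) (at (s, t) within B \<times> A)"
      "(s, t) \<in> B \<times> A \<longrightarrow> l = k s t"
    unfolding rd_continuous2_def by blast
  have "((\<lambda>p. (\<lambda>(u, v). k u v) (snd p, fst p)) \<longlongrightarrow> l) (at (t, s) within A \<times> B)"
  proof (rule filterlim_compose[OF l(1)])
    show "filterlim (\<lambda>p. (snd p, fst p)) (at (s, t) within B \<times> A) (at (t, s) within A \<times> B)"
      unfolding filterlim_at
      by (auto intro!: tendsto_eq_intros always_eventually simp: eventually_at_filter)
  qed
  then show "\<exists>l. ((\<lambda>(u, v). k v u) \<longlongrightarrow> l) (at (t, s) within A \<times> B) \<and> ((t, s) \<in> A \<times> B \<longrightarrow> l = k s t)"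
    using l(2) by (auto simp: case_prod_unfold)
qed

lemma rd_continuous_second_section:
  assumes "rd_continuous2 I k" "t \<in> I" shows "rd_continuous I (k t)"
  using rd_continuous_first_section[OF rd_continuous2_swap[OF assms(1)] assms(2)] .

section \<open>The step extension\<close>

text \<open>
  The last point of \<open>I\<close> not after \<open>s\<close>. Inserting \<open>a\<close> makes the supremum run over a nonempty set for
  every real \<open>s\<close>, so that \<open>g \<circ> tfloor\<close> is defined on the whole line by values of \<open>g\<close> on \<open>I\<close>.
\<close>

definition tfloor :: "real \<Rightarrow> real" where
  "tfloor s = Sup (insert a {t\<in>I. t \<le> s})"

lemma tfloor_bdd: "bdd_above (insert a {t\<in>I. t \<le> s})"
  by (rule bdd_aboveI[of _ b]) (use a_in I_bounds in auto)

lemma tfloor_in: "tfloor s \<in> I"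
proof -
  have "tfloor s \<in> closure (insert a {t\<in>I. t \<le> s})"
    unfolding tfloor_def by (rule closure_contains_Sup[OF _ tfloor_bdd]) auto
  also have "\<dots> \<subseteq> I" by (rule closure_minimal) (auto simp: closed_I a_in)
  finally show ?thesis .
qed

lemma tfloor_greatest: "t \<in> I \<Longrightarrow> t \<le> s \<Longrightarrow> t \<le> tfloor s"
  unfolding tfloor_def by (rule cSup_upper[OF _ tfloor_bdd]) auto

lemma tfloor_le: "a \<le> s \<Longrightarrow> tfloor s \<le> s"
  unfolding tfloor_def by (rule cSup_least) auto

lemma tfloor_eq: "s \<in> I \<Longrightarrow> tfloor s = s"
  using tfloor_le[of s] tfloor_greatest[of s s] I_bounds by force

lemma mono_tfloor: "mono tfloor"
  unfolding tfloor_def mono_def by (intro allI impI cSup_subset_mono[OF _ tfloor_bdd]) auto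

lemma tfloor_cong:
  assumes "a \<le> s" "s \<le> u" "\<And>t. t \<in> I \<Longrightarrow> t \<le> u \<Longrightarrow> t \<le> s" shows "tfloor u = tfloor s"
proof (rule antisym)
  show "tfloor u \<le> tfloor s"
    using assms tfloor_le[of u] by (intro tfloor_greatest tfloor_in) (auto simp: tfloor_in)
  show "tfloor s \<le> tfloor u" using mono_tfloor assms by (auto simp: mono_def)
qed

lemma tfloor_locally_constant:
  assumes "s \<notin> I" shows "\<forall>\<^sub>F u in nhds s. tfloor u = tfloor s"
proof -
  have "\<forall>\<^sub>F u in nhds s. \<forall>t\<in>I. (t \<le> u) = (t \<le> s)"
  proof -
    from closed_I assms obtain e where e: "e > 0" "ball s e \<subseteq> - I"
      by (meson ComplI open_Compl open_contains_ball)
    have "\<forall>\<^sub>F u in nhds s. dist u s < e" using e by (auto simp: eventually_nhds_metric)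
    then show ?thesis
    proof eventually_elim
      fix u assume u: "dist u s < e"
      show "\<forall>t\<in>I. (t \<le> u) = (t \<le> s)"
      proof
        fix t assume "t \<in> I"
        then have "t \<notin> ball s e" using e by blast
        with u show "(t \<le> u) = (t \<le> s)" by (auto simp: dist_real_def)
      qed
    qed
  qed
  then show ?thesis
  proof eventually_elim
    fix u assume "\<forall>t\<in>I. (t \<le> u) = (t \<le> s)"
    then have "{t\<in>I. t \<le> u} = {t\<in>I. t \<le> s}" by auto
    then show "tfloor u = tfloor s" by (simp add: tfloor_def)
  qed
qed

text \<open>
  Each gap to the right of a point that is not right-dense contains a rational, and disjoint gaps
  contain different ones.
\<close>

lemma countable_not_right_dense: "countable {t\<in>I. \<not> right_dense I t}"
proof -
  let ?R = "{t\<in>I. \<not> right_dense I t}"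
  have "\<exists>q\<in>\<rat>. t < q \<and> (\<forall>s\<in>I. t < s \<longrightarrow> q < s)" if "t \<in> ?R" for t
  proof -
    from that obtain e where e: "e > 0" "\<And>s. s \<in> I \<Longrightarrow> t < s \<Longrightarrow> t + e \<le> s"
      by (force simp: right_dense_iff)
    with Rats_dense_in_real[of t "t + e"] show ?thesis by force
  qed
  then obtain q where q: "\<And>t. t \<in> ?R \<Longrightarrow> q t \<in> \<rat> \<and> t < q t \<and> (\<forall>s\<in>I. t < s \<longrightarrow> q t < s)"
    by metis
  have "inj_on q ?R"
  proof (rule inj_onI)
    fix t s assume ts: "t \<in> ?R" "s \<in> ?R" "q t = q s"
    have "\<not> t < s" "\<not> s < t" using q[OF ts(1)] q[OF ts(2)] ts by fastforce+
    then show "t = s" by simp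
  qed
  moreover have "countable (q ` ?R)" by (rule countable_subset[OF _ countable_rat]) (use q in blast)
  ultimately show ?thesis by (rule countable_image_inj_on[rotated])
qed

text \<open>
  The functions on which the Volterra operator is considered. Unlike the rd-continuous functions, they
  are closed under pointwise limits of uniformly bounded sequences.
\<close>

definition bounded_borel :: "(real \<Rightarrow> real) \<Rightarrow> bool" where
  "bounded_borel x \<longleftrightarrow> (\<lambda>s. x (tfloor s)) \<in> borel_measurable borel \<and> (\<exists>M. \<forall>t\<in>I. \<bar>x t\<bar> \<le> M)"

text \<open>
  The extension of an rd-continuous function has only countably many discontinuities: they lie at
  discontinuities of the monotone function \<open>tfloor\<close>, which are the right ends of gaps, or at points of
  \<open>I\<close> that are not right-dense.
\<close>

lemma rd_continuous_imp_bounded_borel: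
  assumes g: "rd_continuous I g" shows "bounded_borel g"
proof -
  let ?X = "{s. \<not> isCont tfloor s} \<union> {t\<in>I. \<not> right_dense I t}"
  have "countable ?X" using mono_ctble_discont[OF mono_tfloor] countable_not_right_dense by simp
  moreover have "continuous_on (- ?X) (\<lambda>s. g (tfloor s))"
  proof (rule continuous_at_imp_continuous_on, rule ballI)
    fix s assume s: "s \<in> - ?X"
    show "isCont (\<lambda>s. g (tfloor s)) s"
    proof (cases "s \<in> I")
      case True
      with s have rd: "right_dense I s" and "isCont tfloor s" by auto
      then have "(tfloor \<longlongrightarrow> s) (at s)" using tfloor_eq[OF True] by (simp add: isCont_def)
      moreover have "continuous (at s within I) g"
        using g rd True by (auto simp: rd_continuous_def)
      ultimately have "((\<lambda>u. g (tfloor u)) \<longlongrightarrow> g s) (at s)"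
        using continuous_within_tendsto_compose'[of s I g tfloor] tfloor_in by blast
      then show ?thesis using tfloor_eq[OF True] by (simp add: isCont_def)
    next
      case False
      have "\<forall>\<^sub>F u in nhds s. g (tfloor u) = g (tfloor s)"
        using tfloor_locally_constant[OF False] by eventually_elim simp
      then show ?thesis using isCont_cong by force
    qed
  qed
  ultimately have "(\<lambda>s. g (tfloor s)) \<in> borel_measurable borel"
    by (rule borel_measurable_continuous_countable_exceptions)
  with rd_continuous_bounded[OF g] show ?thesis by (simp add: bounded_borel_def)
qed

lemma bounded_borel_integrable:
  assumes "bounded_borel x" shows "(\<lambda>s. x (tfloor s)) integrable_on {c..d}"
proof -
  from assms obtain M where M: "\<forall>t\<in>I. \<bar>x t\<bar> \<le> M" and x: "(\<lambda>s. x (tfloor s)) \<in> borel_measurable borel"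
    by (auto simp: bounded_borel_def)
  show ?thesis
  proof (rule measurable_bounded_by_integrable_imp_integrable)
    show "(\<lambda>s. x (tfloor s)) \<in> borel_measurable (lebesgue_on {c..d})"
      using x by (intro measurable_restrict_space1 measurable_completion) (simp add: measurable_lborel1)
    show "(\<lambda>s. M) integrable_on {c..d}" by (rule integrable_const_ivl)
    show "norm (x (tfloor s)) \<le> M" for s using M tfloor_in by simp
  qed simp
qed

lemma bounded_borel_mult:
  assumes "bounded_borel x" "bounded_borel y" shows "bounded_borel (\<lambda>s. x s * y s)"
proof -
  from assms obtain M N where M: "\<forall>t\<in>I. \<bar>x t\<bar> \<le> M" and N: "\<forall>t\<in>I. \<bar>y t\<bar> \<le> N"
    by (auto simp: bounded_borel_def)
  have "\<bar>x t * y t\<bar> \<le> M * N" if "t \<in> I" for t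
    unfolding abs_mult using M N that by (intro mult_mono) (auto intro: order_trans[OF abs_ge_zero])
  then show ?thesis using assms by (auto simp: bounded_borel_def intro!: borel_measurable_times)
qed

lemma bounded_borel_diff:
  assumes "bounded_borel x" "bounded_borel y" shows "bounded_borel (\<lambda>s. x s - y s)"
proof -
  from assms obtain M N where M: "\<forall>t\<in>I. \<bar>x t\<bar> \<le> M" and N: "\<forall>t\<in>I. \<bar>y t\<bar> \<le> N"
    by (auto simp: bounded_borel_def)
  have "\<bar>x t - y t\<bar> \<le> M + N" if "t \<in> I" for t
    using M N that abs_triangle_ineq4[of "x t" "y t"] by fastforce
  then show ?thesis using assms by (auto simp: bounded_borel_def intro!: borel_measurable_diff)
qed

section \<open>The delta integral as an ordinary integral\<close>

definition step_integral :: "(real \<Rightarrow> real) \<Rightarrow> real \<Rightarrow> real" where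
  "step_integral g t = integral {a..t} (\<lambda>s. g (tfloor s))"

text \<open>
  This one estimate yields the Lipschitz bound (\<open>c = 0\<close>), the increment across a gap (\<open>e = 0\<close>) and the
  derivative at right-dense points. The right end point \<open>t\<close> must be exempt from the hypothesis, since the
  extension may jump at the end of a gap.
\<close>

lemma step_integral_deviation:
  assumes g: "bounded_borel g" and st: "a \<le> s" "s \<le> t"
    and dev: "\<And>u. s \<le> u \<Longrightarrow> u < t \<Longrightarrow> \<bar>g (tfloor u) - c\<bar> \<le> e"
  shows "\<bar>step_integral g t - step_integral g s - c * (t - s)\<bar> \<le> e * (t - s)"
proof -
  let ?h = "\<lambda>u. g (tfloor u)"
  have "step_integral g s + integral {s..t} ?h = step_integral g t"
    unfolding step_integral_def
    using st by (intro Henstock_Kurzweil_Integration.integral_combine bounded_borel_integrable g) auto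
  moreover have "integral {s..t} (\<lambda>u. ?h u - c) = integral {s..t} ?h - c * (t - s)"
    using st by (subst Henstock_Kurzweil_Integration.integral_diff) (auto intro: bounded_borel_integrable g)
  moreover have "norm (integral {s..t} (\<lambda>u. ?h u - c))
      \<le> integral {s..t} (\<lambda>u. if u = t then \<bar>?h t - c\<bar> else e)"
  proof (rule Henstock_Kurzweil_Integration.integral_norm_bound_integral)
    show "(\<lambda>u. ?h u - c) integrable_on {s..t}"
      by (intro integrable_diff bounded_borel_integrable g integrable_const_ivl)
    show "(\<lambda>u. if u = t then \<bar>?h t - c\<bar> else e) integrable_on {s..t}"
      by (rule integrable_spike[of "\<lambda>u. e" _ "{t}"]) auto
  qed (use dev in auto)
  moreover have "integral {s..t} (\<lambda>u. if u = t then \<bar>?h t - c\<bar> else e) = e * (t - s)"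
    using st integral_spike[of "{t}" "{s..t}" "\<lambda>u. if u = t then \<bar>?h t - c\<bar> else e" "\<lambda>u. e"]
    by (auto simp: mult.commute)
  ultimately show ?thesis by (simp add: algebra_simps)
qed

lemma step_integral_lipschitz:
  assumes g: "bounded_borel g" and M: "\<And>t. t \<in> I \<Longrightarrow> \<bar>g t\<bar> \<le> M" and ts: "t \<in> I" "s \<in> I"
  shows "\<bar>step_integral g t - step_integral g s\<bar> \<le> M * \<bar>t - s\<bar>"
  using step_integral_deviation[OF g, of s t 0 M] step_integral_deviation[OF g, of t s 0 M]
    ts I_bounds M tfloor_in by (cases "s \<le> t") (auto simp: abs_minus_commute)

lemma step_integral_cong:
  assumes "\<And>s. s \<in> I \<Longrightarrow> g s = h s" shows "step_integral g t = step_integral h t"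
  unfolding step_integral_def using assms tfloor_in by simp

lemma step_integral_diff:
  assumes "bounded_borel g" "bounded_borel h"
  shows "step_integral (\<lambda>s. g s - h s) t = step_integral g t - step_integral h t"
  unfolding step_integral_def
  by (intro Henstock_Kurzweil_Integration.integral_diff bounded_borel_integrable assms)

text \<open>
  At a right-dense point the derivative comes from continuity of \<open>g\<close>. At a right-scattered point \<open>t\<close>
  with a gap up to \<open>\<sigma>\<close> it comes from the exact increment \<open>g t * (\<sigma> - t)\<close> and, for \<open>s\<close> slightly to the
  left of \<open>t\<close>, from the mere boundedness of \<open>g\<close>.
\<close>

lemma delta_antiderivative_step_integral:
  assumes g: "rd_continuous I g" shows "delta_antiderivative I g (step_integral g)"
proof -
  note bb = rd_continuous_imp_bounded_borel[OF g]
  then obtain M where M: "\<And>t. t \<in> I \<Longrightarrow> \<bar>g t\<bar> \<le> M" by (auto simp: bounded_borel_def)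
  have M0: "0 \<le> M" using M[OF a_in] by simp
  have "continuous_on I (step_integral g)"
  proof (rule continuous_on_iff[THEN iffD2], intro ballI allI impI)
    fix t e :: real assume "t \<in> I" "0 < e"
    show "\<exists>d>0. \<forall>s\<in>I. dist s t < d \<longrightarrow> dist (step_integral g s) (step_integral g t) < e"
    proof (intro exI conjI ballI impI)
      show "0 < e / (M + 1)" using \<open>0 < e\<close> M0 by simp
      fix s assume s: "s \<in> I" "dist s t < e / (M + 1)"
      have "\<bar>step_integral g s - step_integral g t\<bar> \<le> M * \<bar>s - t\<bar>"
        using step_integral_lipschitz[OF bb M] s \<open>t \<in> I\<close> by blast
      also have "\<dots> \<le> (M + 1) * \<bar>s - t\<bar>" by (simp add: mult_right_mono)
      also have "\<dots> < e" using s M0 by (simp add: dist_real_def field_simps)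
      finally show "dist (step_integral g s) (step_integral g t) < e" by (simp add: dist_real_def)
    qed
  qed
  moreover have "has_delta_derivative I (step_integral g) (g t) t" if t: "t \<in> I" "\<exists>s\<in>I. t < s" for t
  proof (cases "right_dense I t")
    case True
    then have fw: "fwd_jump I t = t" by (simp add: right_dense_def)
    have cont: "continuous (at t within I) g" using g t True by (auto simp: rd_continuous_def)
    show ?thesis
      unfolding has_delta_derivative_def fw
    proof (intro allI impI)
      fix e :: real assume "e > 0"
      with cont obtain d where d: "d > 0" "\<And>s. s \<in> I \<Longrightarrow> \<bar>s - t\<bar> < d \<Longrightarrow> \<bar>g s - g t\<bar> \<le> e"
        unfolding continuous_within_eps_delta dist_real_def by (meson less_imp_le)
      have "\<bar>step_integral g t - step_integral g s - g t * (t - s)\<bar> \<le> e * \<bar>t - s\<bar>"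
        if s: "s \<in> I" "\<bar>s - t\<bar> < d" for s
      proof -
        \<comment> \<open>As \<open>s\<close> and \<open>t\<close> both belong to \<open>I\<close>, so does a point \<open>tfloor u\<close> between them.\<close>
        have dev: "\<bar>g (tfloor u) - g t\<bar> \<le> e" if u: "min s t \<le> u" "u \<le> max s t" for u
        proof (rule d(2)[OF tfloor_in])
          have "a \<le> u" using u I_bounds(1)[OF s(1)] I_bounds(1)[OF t(1)] by linarith
          then have "tfloor u \<le> u" by (rule tfloor_le)
          moreover have "min s t \<le> tfloor u"
            using u s(1) t(1) by (intro tfloor_greatest) (auto simp: min_def)
          ultimately show "\<bar>tfloor u - t\<bar> < d" using s(2) u by (auto simp: min_def max_def split: if_splits)
        qed
        show ?thesis
        proof (cases "s \<le> t")
          case True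
          then show ?thesis using step_integral_deviation[OF bb, of s t "g t" e] dev I_bounds s by auto
        next
          case False
          then have "\<bar>step_integral g s - step_integral g t - g t * (s - t)\<bar> \<le> e * (s - t)"
            using dev I_bounds t by (intro step_integral_deviation[OF bb]) auto
          moreover have "step_integral g t - step_integral g s - g t * (t - s) =
              - (step_integral g s - step_integral g t - g t * (s - t))" by (simp add: algebra_simps)
          then have "\<bar>step_integral g t - step_integral g s - g t * (t - s)\<bar> =
              \<bar>step_integral g s - step_integral g t - g t * (s - t)\<bar>" by (simp only: abs_minus_cancel)
          moreover have "\<bar>t - s\<bar> = s - t" using False by simp
          ultimately show ?thesis by simp
        qed
      qed
      with d(1) show "\<exists>d>0. \<forall>s\<in>I. \<bar>s - t\<bar> < d \<longrightarrow>
          \<bar>step_integral g t - step_integral g s - g t * (t - s)\<bar> \<le> e * \<bar>t - s\<bar>" by blast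
    qed
  next
    case False
    define \<sigma> where "\<sigma> = fwd_jump I t"
    have \<sigma>: "t < \<sigma>" using False t fwd_jump_ge[of t] by (auto simp: right_dense_def \<sigma>_def)
    have gap: "s \<le> t" if "s \<in> I" "s < \<sigma>" for s
      using fwd_jump_le[OF that(1), of t] that(2) by (force simp: \<sigma>_def)
    have jump: "step_integral g \<sigma> - step_integral g t = g t * (\<sigma> - t)"
    proof -
      have "tfloor u = t" if "t \<le> u" "u < \<sigma>" for u
        using tfloor_cong[of t u] gap that tfloor_eq[OF t(1)] I_bounds[OF t(1)] by auto
      then have "\<bar>step_integral g \<sigma> - step_integral g t - g t * (\<sigma> - t)\<bar> \<le> 0 * (\<sigma> - t)"
        using \<sigma> I_bounds[OF t(1)] by (intro step_integral_deviation[OF bb]) auto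
      then show ?thesis by simp
    qed
    show ?thesis
      unfolding has_delta_derivative_def \<sigma>_def[symmetric]
    proof (intro allI impI)
      fix e :: real assume e: "e > 0"
      show "\<exists>d>0. \<forall>s\<in>I. \<bar>s - t\<bar> < d \<longrightarrow>
          \<bar>step_integral g \<sigma> - step_integral g s - g t * (\<sigma> - s)\<bar> \<le> e * \<bar>\<sigma> - s\<bar>"
      proof (intro exI conjI ballI impI)
        \<comment> \<open>The first bound keeps \<open>s\<close> out of the points beyond the gap; the second one makes the error
          \<open>2 * M * (t - s)\<close> on the left of \<open>t\<close> small against the fixed length of the gap.\<close>
        let ?d = "min (\<sigma> - t) (e * (\<sigma> - t) / (2 * M + 1))"
        show "0 < ?d" using \<sigma> e M0 by simp
        fix s assume s: "s \<in> I" "\<bar>s - t\<bar> < ?d"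
        then have st: "s \<le> t" using gap by auto
        have "\<bar>step_integral g t - step_integral g s - g t * (t - s)\<bar> \<le> (2 * M) * (t - s)"
        proof (intro step_integral_deviation[OF bb])
          show "\<bar>g (tfloor u) - g t\<bar> \<le> 2 * M" for u using M[OF tfloor_in[of u]] M[OF t(1)] by auto
        qed (use st I_bounds s in auto)
        also have "\<dots> \<le> (2 * M + 1) * (t - s)" using st by (intro mult_right_mono) auto
        also have "\<dots> \<le> e * (\<sigma> - t)" using s(2) st M0 by (simp add: field_simps)
        also have "\<dots> \<le> e * \<bar>\<sigma> - s\<bar>" using st \<sigma> e by (intro mult_left_mono) auto
        finally show "\<bar>step_integral g \<sigma> - step_integral g s - g t * (\<sigma> - s)\<bar> \<le> e * \<bar>\<sigma> - s\<bar>"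
          using jump by (simp add: algebra_simps)
      qed
    qed
  qed
  ultimately show ?thesis by (auto simp: delta_antiderivative_def)
qed

lemma delta_antiderivative_diff:
  assumes "delta_antiderivative I g F" "delta_antiderivative I g G"
  shows "delta_antiderivative I (\<lambda>_. 0) (\<lambda>t. F t - G t)"
  unfolding delta_antiderivative_def
proof (intro conjI ballI impI)
  show "continuous_on I (\<lambda>t. F t - G t)"
    using assms by (auto simp: delta_antiderivative_def intro: continuous_on_diff)
  fix t assume t: "t \<in> I" "\<exists>s\<in>I. t < s"
  show "has_delta_derivative I (\<lambda>t. F t - G t) 0 t"
    unfolding has_delta_derivative_def
  proof (intro allI impI)
    fix e :: real assume "e > 0"
    then have "e / 2 > 0" by simp
    moreover have "has_delta_derivative I F (g t) t" "has_delta_derivative I G (g t) t"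
      using assms t unfolding delta_antiderivative_def by blast+
    ultimately obtain d d' where d: "d > 0" "d' > 0"
      and F: "\<forall>s\<in>I. \<bar>s - t\<bar> < d \<longrightarrow>
        \<bar>F (fwd_jump I t) - F s - g t * (fwd_jump I t - s)\<bar> \<le> e / 2 * \<bar>fwd_jump I t - s\<bar>"
      and G: "\<forall>s\<in>I. \<bar>s - t\<bar> < d' \<longrightarrow>
        \<bar>G (fwd_jump I t) - G s - g t * (fwd_jump I t - s)\<bar> \<le> e / 2 * \<bar>fwd_jump I t - s\<bar>"
      unfolding has_delta_derivative_def by fast
    show "\<exists>d>0. \<forall>s\<in>I. \<bar>s - t\<bar> < d \<longrightarrow>
        \<bar>F (fwd_jump I t) - G (fwd_jump I t) - (F s - G s) - 0 * (fwd_jump I t - s)\<bar>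
          \<le> e * \<bar>fwd_jump I t - s\<bar>"
    proof (intro exI[of _ "min d d'"] conjI ballI impI)
      fix s assume s: "s \<in> I" "\<bar>s - t\<bar> < min d d'"
      let ?D = "\<lambda>J. J (fwd_jump I t) - J s - g t * (fwd_jump I t - s)"
      have "\<bar>?D F - ?D G\<bar> \<le> \<bar>?D F\<bar> + \<bar>?D G\<bar>" by (rule abs_triangle_ineq4)
      also have "\<dots> \<le> e / 2 * \<bar>fwd_jump I t - s\<bar> + e / 2 * \<bar>fwd_jump I t - s\<bar>"
        using F G s by (intro add_mono) auto
      finally show "\<bar>F (fwd_jump I t) - G (fwd_jump I t) - (F s - G s) - 0 * (fwd_jump I t - s)\<bar>
          \<le> e * \<bar>fwd_jump I t - s\<bar>"
        by (simp add: algebra_simps)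
    qed (use d in simp)
  qed
qed

text \<open>
  The mean value argument for zero derivative: for each \<open>e > 0\<close>, the bound \<open>\<bar>H s - H a\<bar> \<le> e * (s - a)\<close>
  holds up to some largest point \<open>c\<close> of \<open>I\<close>. If \<open>c < b\<close>, the derivative at \<open>c\<close> carries the bound
  further, either across the gap after \<open>c\<close> or to some point of \<open>I\<close> right after \<open>c\<close>.
\<close>

lemma delta_antiderivative_zero_imp_constant:
  assumes H: "delta_antiderivative I (\<lambda>_. 0) H" and t: "t \<in> I"
  shows "H t = H a"
proof -
  have cont: "continuous_on I H" using H by (simp add: delta_antiderivative_def)
  have small: "\<bar>H t - H a\<bar> \<le> e * (t - a)" if e: "e > 0" for e
  proof -
    define good where "good s \<longleftrightarrow> \<bar>H s - H a\<bar> \<le> e * (s - a)" for s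
    define S where "S = {c\<in>I. \<forall>s\<in>I. s \<le> c \<longrightarrow> good s}"
    define c where "c = Sup S"
    have "a \<in> S" using a_in I_bounds by (force simp: S_def good_def)
    have bdd: "bdd_above S" by (rule bdd_aboveI[of _ b]) (auto simp: S_def I_bounds)
    have below: "good s" if "s \<in> I" "s < c" for s
    proof -
      obtain u where "u \<in> S" "s < u" using less_cSupD[of S s] \<open>a \<in> S\<close> \<open>s < c\<close> unfolding c_def by blast
      then show ?thesis using \<open>s \<in> I\<close> by (auto simp: S_def)
    qed
    have "c \<in> closure S" unfolding c_def using \<open>a \<in> S\<close> bdd by (intro closure_contains_Sup) auto
    moreover have "closed {s\<in>I. good s}"
      unfolding good_def
      by (intro continuous_on_closed_Collect_le[OF _ _ closed_I] continuous_intros cont)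
    then have "closure S \<subseteq> {s\<in>I. good s}" by (intro closure_minimal) (auto simp: S_def)
    ultimately have c: "c \<in> I" "good c" by auto
    with below have "c \<in> S" by (auto simp: S_def order_le_less)
    have "c = b"
    proof (rule ccontr)
      assume "c \<noteq> b"
      then have "c < b" using I_bounds c by force
      then have ex: "\<exists>s\<in>I. c < s" using b_in by blast
      let ?\<sigma> = "fwd_jump I c"
      from H c ex e obtain d where d: "d > 0"
          "\<And>s. s \<in> I \<Longrightarrow> \<bar>s - c\<bar> < d \<Longrightarrow> \<bar>H ?\<sigma> - H s\<bar> \<le> e * \<bar>?\<sigma> - s\<bar>"
        unfolding delta_antiderivative_def has_delta_derivative_def by fastforce
      have "\<exists>r\<in>I. c < r \<and> (\<forall>s\<in>I. c < s \<longrightarrow> s \<le> r \<longrightarrow> \<bar>H s - H c\<bar> \<le> e * (s - c))"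
      proof (cases "right_dense I c")
        case True
        then obtain r where r: "r \<in> I" "c < r" "r < c + d" using d(1) by (auto simp: right_dense_iff)
        have "\<bar>H s - H c\<bar> \<le> e * (s - c)" if "s \<in> I" "c < s" "s \<le> r" for s
          using d(2)[of s] that r True by (auto simp: right_dense_def abs_minus_commute)
        with r show ?thesis by blast
      next
        case False
        then have "c < ?\<sigma>" using ex fwd_jump_ge[of c] by (auto simp: right_dense_def)
        moreover have "\<bar>H s - H c\<bar> \<le> e * (s - c)" if "s \<in> I" "c < s" "s \<le> ?\<sigma>" for s
        proof -
          have "s = ?\<sigma>" using fwd_jump_le[of s c] that by simp
          then show ?thesis using d(2)[of c] d(1) c(1) that by simp
        qed
        ultimately show ?thesis using fwd_jump_in[OF c(1)] by blast
      qed
      then obtain r where r: "r \<in> I" "c < r"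
        "\<And>s. s \<in> I \<Longrightarrow> c < s \<Longrightarrow> s \<le> r \<Longrightarrow> \<bar>H s - H c\<bar> \<le> e * (s - c)" by blast
      have "good s" if "s \<in> I" "s \<le> r" for s
      proof (cases "s \<le> c")
        case True
        then show ?thesis using that \<open>c \<in> S\<close> by (auto simp: S_def)
      next
        case False
        then have "\<bar>H s - H c\<bar> \<le> e * (s - c)" using r that by auto
        then show ?thesis using c(2) by (simp add: good_def algebra_simps)
      qed
      then have "r \<in> S" using r by (auto simp: S_def)
      then have "r \<le> c" unfolding c_def using bdd by (rule cSup_upper)
      with r show False by simp
    qed
    then show ?thesis using \<open>c \<in> S\<close> t I_bounds by (auto simp: S_def good_def)
  qed
  have "\<bar>H t - H a\<bar> \<le> 0"
  proof (rule field_le_epsilon)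
    fix e :: real assume "e > 0"
    have ta: "0 \<le> t - a" using I_bounds t by simp
    then have "\<bar>H t - H a\<bar> \<le> e / (t - a + 1) * (t - a)" using \<open>e > 0\<close> by (intro small) auto
    also have "\<dots> \<le> e" using ta \<open>e > 0\<close> by (simp add: field_simps)
    finally show "\<bar>H t - H a\<bar> \<le> 0 + e" by simp
  qed
  then show ?thesis by simp
qed

lemma delta_integral_eq_step_integral:
  assumes g: "rd_continuous I g" and t: "t \<in> I"
  shows "delta_integral I g a t = step_integral g t"
  unfolding delta_integral_def
proof (rule the_equality)
  have "step_integral g a = 0" by (simp add: step_integral_def)
  then show "\<exists>G. delta_antiderivative I g G \<and> step_integral g t = G t - G a"
    using delta_antiderivative_step_integral[OF g] by (intro exI[of _ "step_integral g"]) simp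
  fix J assume "\<exists>G. delta_antiderivative I g G \<and> J = G t - G a"
  then obtain G where G: "delta_antiderivative I g G" "J = G t - G a" by blast
  have "G t - step_integral g t = G a - step_integral g a"
    using delta_antiderivative_zero_imp_constant[OF delta_antiderivative_diff[OF G(1)
      delta_antiderivative_step_integral[OF g]] t] .
  then show "J = step_integral g t" using G(2) \<open>step_integral g a = 0\<close> by simp
qed

end

section \<open>The Volterra operator\<close>

locale volterra_kernel = compact_time_scale +
  fixes k :: "real \<Rightarrow> real \<Rightarrow> real" and K :: real
  assumes rd_k: "rd_continuous2 I k"
    and k_bound: "\<And>t s. t \<in> I \<Longrightarrow> s \<in> I \<Longrightarrow> \<bar>k t s\<bar> \<le> K"
begin

lemma K_nonneg: "0 \<le> K"
  using k_bound[OF a_in a_in] by simp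

definition volterra :: "(real \<Rightarrow> real) \<Rightarrow> real \<Rightarrow> real" where
  "volterra x t = step_integral (\<lambda>s. k t s * x s) t"

lemma bounded_borel_kernel_mult:
  assumes "t \<in> I" "bounded_borel x" shows "bounded_borel (\<lambda>s. k t s * x s)"
  using rd_continuous_second_section[OF rd_k assms(1)]
  by (intro bounded_borel_mult rd_continuous_imp_bounded_borel assms(2))

text \<open>
  Moving the first argument of the kernel is a matter of dominated convergence, because the kernel is
  bounded and converges for each fixed second argument; moving the end point of integration costs at
  most \<open>K * M\<close> times the distance.
\<close>

lemma volterra_tendsto:
  assumes x: "bounded_borel x" and A: "A \<subseteq> I" and t: "t \<in> I"
    and lim: "\<And>s. s \<in> I \<Longrightarrow> ((\<lambda>u. k u s) \<longlongrightarrow> l s) (at t within A)"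
  shows "(volterra x \<longlongrightarrow> step_integral (\<lambda>s. l s * x s) t) (at t within A)"
  unfolding tendsto_at_iff_sequentially comp_def
proof (intro allI impI)
  fix X assume "\<forall>i. X i \<in> A - {t}" and X: "X \<longlonglongrightarrow> t"
  then have X_in: "X n \<in> I" "X n \<in> A - {t}" for n using A by auto
  obtain M where M: "\<And>s. s \<in> I \<Longrightarrow> \<bar>x s\<bar> \<le> M" using x by (auto simp: bounded_borel_def)
  have KM: "\<bar>k u s * x s\<bar> \<le> K * M" if "u \<in> I" "s \<in> I" for u s
    unfolding abs_mult using k_bound M that K_nonneg by (intro mult_mono) auto
  have "(\<lambda>n. integral {a..t} (\<lambda>s. k (X n) (tfloor s) * x (tfloor s)))
      \<longlonglongrightarrow> integral {a..t} (\<lambda>s. l (tfloor s) * x (tfloor s))"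
  proof (rule dominated_convergence(2)[where h = "\<lambda>s. K * M"])
    show "(\<lambda>s. k (X n) (tfloor s) * x (tfloor s)) integrable_on {a..t}" for n
      using bounded_borel_integrable[OF bounded_borel_kernel_mult[OF X_in(1) x]] .
    show "(\<lambda>n. k (X n) (tfloor s) * x (tfloor s)) \<longlonglongrightarrow> l (tfloor s) * x (tfloor s)" for s
      using lim[OF tfloor_in[of s]] X X_in(2) unfolding tendsto_at_iff_sequentially comp_def
      by (intro tendsto_mult tendsto_const) blast
  qed (use KM X_in(1) tfloor_in in auto)
  moreover have "(\<lambda>n. volterra x (X n) - step_integral (\<lambda>s. k (X n) s * x s) t) \<longlonglongrightarrow> 0"
  proof (rule Lim_null_comparison)
    show "\<forall>\<^sub>F n in sequentially. norm (volterra x (X n) - step_integral (\<lambda>s. k (X n) s * x s) t)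
        \<le> K * M * \<bar>X n - t\<bar>"
      unfolding volterra_def real_norm_def
      using step_integral_lipschitz[OF bounded_borel_kernel_mult[OF X_in(1) x] KM[OF X_in(1)] X_in(1) t]
      by (intro always_eventually allI)
    have "(\<lambda>n. K * M * \<bar>X n - t\<bar>) \<longlonglongrightarrow> K * M * \<bar>t - t\<bar>" by (intro tendsto_intros X)
    then show "(\<lambda>n. K * M * \<bar>X n - t\<bar>) \<longlonglongrightarrow> 0" by simp
  qed
  ultimately have "(\<lambda>n. step_integral (\<lambda>s. k (X n) s * x s) t
      + (volterra x (X n) - step_integral (\<lambda>s. k (X n) s * x s) t))
      \<longlonglongrightarrow> step_integral (\<lambda>s. l s * x s) t + 0"
    unfolding step_integral_def by (rule tendsto_add)
  then show "(\<lambda>n. volterra x (X n)) \<longlonglongrightarrow> step_integral (\<lambda>s. l s * x s) t" by simp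
qed

text \<open>
  The smoothing property: \<open>volterra x\<close> inherits its limits in \<open>t\<close> from the kernel alone.
\<close>

lemma rd_continuous_volterra:
  assumes x: "bounded_borel x" shows "rd_continuous I (volterra x)"
  unfolding rd_continuous_def
proof (intro ballI conjI impI)
  fix t assume t: "t \<in> I"
  note sec = rd_continuous_first_section[OF rd_k]
  show "continuous (at t within I) (volterra x)" if "right_dense I t"
  proof -
    have "((\<lambda>u. k u s) \<longlongrightarrow> k t s) (at t within I)" if "s \<in> I" for s
      using sec[OF that] t \<open>right_dense I t\<close> by (auto simp: rd_continuous_def continuous_within)
    from volterra_tendsto[OF x order_refl t this] show ?thesis
      by (simp add: continuous_within volterra_def)
  qed
  show "\<exists>l. (volterra x \<longlongrightarrow> l) (at t within I \<inter> {..<t})" if "left_dense I t"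
  proof -
    have "\<exists>l. ((\<lambda>u. k u s) \<longlongrightarrow> l) (at t within I \<inter> {..<t})" if "s \<in> I" for s
      using sec[OF that] t \<open>left_dense I t\<close> by (auto simp: rd_continuous_def)
    then obtain l where "\<And>s. s \<in> I \<Longrightarrow> ((\<lambda>u. k u s) \<longlongrightarrow> l s) (at t within I \<inter> {..<t})" by metis
    from volterra_tendsto[OF x _ t this] show ?thesis by blast
  qed
qed

lemma bounded_borel_volterra: "bounded_borel x \<Longrightarrow> bounded_borel (volterra x)"
  by (rule rd_continuous_imp_bounded_borel[OF rd_continuous_volterra])

lemma volterra_eq_delta_integral:
  assumes "rd_continuous I x" "t \<in> I"
  shows "delta_integral I (\<lambda>s. k t s * x s) a t = volterra x t"
  unfolding volterra_def using rd_continuous_second_section[OF rd_k] assms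
  by (intro delta_integral_eq_step_integral rd_continuous_mult)

lemma volterra_cong: "(\<And>s. s \<in> I \<Longrightarrow> x s = y s) \<Longrightarrow> volterra x t = volterra y t"
  unfolding volterra_def by (intro step_integral_cong) simp

lemma volterra_diff:
  assumes "bounded_borel x" "bounded_borel y" "t \<in> I"
  shows "volterra (\<lambda>s. x s - y s) t = volterra x t - volterra y t"
  unfolding volterra_def right_diff_distrib
  using assms by (intro step_integral_diff bounded_borel_kernel_mult)

section \<open>The Neumann series\<close>

lemma bounded_borel_funpow_volterra: "bounded_borel r \<Longrightarrow> bounded_borel ((volterra ^^ n) r)"
  by (induction n) (auto intro: bounded_borel_volterra)

text \<open>
  The classical Volterra estimate carries over to a time scale because \<open>tfloor s - a \<le> s - a\<close>: the
  step extension of \<open>(s - a)\<^sup>n\<close> is dominated by the power itself, whose ordinary integral produces the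
  next factorial.
\<close>

lemma funpow_volterra_bound:
  assumes r: "bounded_borel r" and \<epsilon>: "\<And>t. t \<in> I \<Longrightarrow> \<bar>r t\<bar> \<le> \<epsilon>" and "t \<in> I"
  shows "\<bar>(volterra ^^ n) r t\<bar> \<le> \<epsilon> * ((K * (t - a)) ^ n /\<^sub>R fact n)"
  using \<open>t \<in> I\<close>
proof (induction n arbitrary: t)
  case 0
  then show ?case using \<epsilon> by simp
next
  case (Suc n)
  have \<epsilon>0: "0 \<le> \<epsilon>" using \<epsilon>[OF a_in] by simp
  let ?y = "(volterra ^^ n) r" and ?c = "\<epsilon> * K ^ Suc n / fact n"
  have "((\<lambda>s. ?c * (s - a) ^ n) has_integral
      ?c * (t - a) ^ Suc n / (n + 1) - ?c * (a - a) ^ Suc n / (n + 1)) {a..t}"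
  proof (rule fundamental_theorem_of_calculus)
    show "((\<lambda>s. ?c * (s - a) ^ Suc n / (n + 1)) has_vector_derivative ?c * (s - a) ^ n) (at s within {a..t})" for s
      unfolding has_real_derivative_iff_has_vector_derivative[symmetric]
      by (rule derivative_eq_intros refl | simp)+
  qed (use I_bounds Suc.prems in auto)
  then have int: "((\<lambda>s. ?c * (s - a) ^ n) has_integral ?c * (t - a) ^ Suc n / (n + 1)) {a..t}" by simp
  have "volterra ?y t = integral {a..t} (\<lambda>s. k t (tfloor s) * ?y (tfloor s))"
    by (simp add: volterra_def step_integral_def)
  also have "norm \<dots> \<le> integral {a..t} (\<lambda>s. ?c * (s - a) ^ n)"
  proof (rule Henstock_Kurzweil_Integration.integral_norm_bound_integral)
    show "(\<lambda>s. k t (tfloor s) * ?y (tfloor s)) integrable_on {a..t}"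
      using bounded_borel_integrable[OF bounded_borel_kernel_mult[OF Suc.prems
        bounded_borel_funpow_volterra[OF r]]] .
    show "(\<lambda>s. ?c * (s - a) ^ n) integrable_on {a..t}" using int by blast
    fix s assume s: "s \<in> {a..t}"
    have "a \<le> tfloor s" using I_bounds tfloor_in by blast
    then have pw: "(tfloor s - a) ^ n \<le> (s - a) ^ n" using tfloor_le[of s] s by (intro power_mono) auto
    have "norm (k t (tfloor s) * ?y (tfloor s)) \<le> K * (\<epsilon> * ((K * (tfloor s - a)) ^ n /\<^sub>R fact n))"
      unfolding real_norm_def abs_mult
      using k_bound[OF Suc.prems tfloor_in] Suc.IH[OF tfloor_in] K_nonneg by (intro mult_mono) auto
    also have "\<dots> = ?c * (tfloor s - a) ^ n" unfolding power_mult_distrib by (simp add: field_simps)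
    also have "\<dots> \<le> ?c * (s - a) ^ n"
      using pw \<epsilon>0 K_nonneg by (intro mult_left_mono) (auto intro!: divide_nonneg_nonneg mult_nonneg_nonneg)
    finally show "norm (k t (tfloor s) * ?y (tfloor s)) \<le> ?c * (s - a) ^ n" .
  qed
  also have "\<dots> = ?c * (t - a) ^ Suc n / (n + 1)" using int by (rule integral_unique)
  also have "\<dots> = \<epsilon> * ((K * (t - a)) ^ Suc n /\<^sub>R fact (Suc n))"
    unfolding power_mult_distrib by (simp add: field_simps)
  finally show ?case by simp
qed

definition neumann :: "(real \<Rightarrow> real) \<Rightarrow> real \<Rightarrow> real" where
  "neumann r t = (\<Sum>n. (volterra ^^ n) r t)"

lemma neumann_summable_bound:
  assumes r: "bounded_borel r" and \<epsilon>: "\<And>t. t \<in> I \<Longrightarrow> \<bar>r t\<bar> \<le> \<epsilon>" and t: "t \<in> I"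
  shows "summable (\<lambda>n. \<bar>(volterra ^^ n) r t\<bar>)" "(\<Sum>n. \<bar>(volterra ^^ n) r t\<bar>) \<le> \<epsilon> * exp (K * (b - a))"
proof -
  have sums: "(\<lambda>n. \<epsilon> * ((K * (b - a)) ^ n /\<^sub>R fact n)) sums (\<epsilon> * exp (K * (b - a)))"
    by (intro sums_mult exp_converges)
  have le: "\<bar>(volterra ^^ n) r t\<bar> \<le> \<epsilon> * ((K * (b - a)) ^ n /\<^sub>R fact n)" for n
  proof -
    have "\<bar>(volterra ^^ n) r t\<bar> \<le> \<epsilon> * ((K * (t - a)) ^ n /\<^sub>R fact n)"
      using funpow_volterra_bound[OF r \<epsilon> t] .
    also have "\<dots> \<le> \<epsilon> * ((K * (b - a)) ^ n /\<^sub>R fact n)"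
      using I_bounds[OF t] K_nonneg \<epsilon>[OF t]
      by (intro mult_left_mono scaleR_left_mono power_mono) auto
    finally show ?thesis .
  qed
  show "summable (\<lambda>n. \<bar>(volterra ^^ n) r t\<bar>)"
    by (rule summable_comparison_test'[OF sums_summable[OF sums], of 0]) (use le in simp)
  then show "(\<Sum>n. \<bar>(volterra ^^ n) r t\<bar>) \<le> \<epsilon> * exp (K * (b - a))"
    using suminf_le[OF le _ sums_summable[OF sums]] sums_unique[OF sums] by simp
qed

lemma neumann_bound:
  assumes "bounded_borel r" "\<And>t. t \<in> I \<Longrightarrow> \<bar>r t\<bar> \<le> \<epsilon>" "t \<in> I"
  shows "\<bar>neumann r t\<bar> \<le> \<epsilon> * exp (K * (b - a))"
  using neumann_summable_bound[OF assms] summable_rabs[of "\<lambda>n. (volterra ^^ n) r t"]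
  by (simp add: neumann_def)

lemma bounded_borel_neumann:
  assumes r: "bounded_borel r" shows "bounded_borel (neumann r)"
proof -
  obtain \<epsilon> where "\<And>t. t \<in> I \<Longrightarrow> \<bar>r t\<bar> \<le> \<epsilon>" using r by (auto simp: bounded_borel_def)
  then have "\<forall>t\<in>I. \<bar>neumann r t\<bar> \<le> \<epsilon> * exp (K * (b - a))" using neumann_bound[OF r] by blast
  moreover have "(\<lambda>s. neumann r (tfloor s)) \<in> borel_measurable borel"
    unfolding neumann_def using bounded_borel_funpow_volterra[OF r]
    by (intro borel_measurable_suminf) (simp add: bounded_borel_def)
  ultimately show ?thesis by (auto simp: bounded_borel_def)
qed

text \<open>
  Applying the operator to the partial sums shifts the series by one term, and dominated convergence
  lets the operator pass to the sum.
\<close>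

lemma neumann_fixpoint:
  assumes r: "bounded_borel r" and t: "t \<in> I"
  shows "neumann r t = r t + volterra (neumann r) t"
proof -
  let ?y = "\<lambda>n. (volterra ^^ n) r"
  obtain \<epsilon> where \<epsilon>: "\<And>s. s \<in> I \<Longrightarrow> \<bar>r s\<bar> \<le> \<epsilon>" using r by (auto simp: bounded_borel_def)
  note abs_summable = neumann_summable_bound[OF r \<epsilon>, simplified]
  have summable: "summable (\<lambda>n. ?y n s)" if "s \<in> I" for s
    using abs_summable(1)[OF that] by (rule summable_rabs_cancel)
  have int: "(\<lambda>s. k t (tfloor s) * ?y n (tfloor s)) integrable_on {a..t}" for n
    using bounded_borel_integrable[OF bounded_borel_kernel_mult[OF t bounded_borel_funpow_volterra[OF r]]] .
  have "(\<lambda>N. integral {a..t} (\<lambda>s. \<Sum>n<N. k t (tfloor s) * ?y n (tfloor s)))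
      \<longlonglongrightarrow> integral {a..t} (\<lambda>s. k t (tfloor s) * neumann r (tfloor s))"
  proof (rule dominated_convergence(2)[where h = "\<lambda>s. K * (\<epsilon> * exp (K * (b - a)))"])
    show "(\<lambda>s. \<Sum>n<N. k t (tfloor s) * ?y n (tfloor s)) integrable_on {a..t}" for N
      by (intro integrable_sum int) simp
    show "norm (\<Sum>n<N. k t (tfloor s) * ?y n (tfloor s)) \<le> K * (\<epsilon> * exp (K * (b - a)))" for N s
    proof -
      have "\<bar>\<Sum>n<N. ?y n (tfloor s)\<bar> \<le> (\<Sum>n<N. \<bar>?y n (tfloor s)\<bar>)" by (rule sum_abs)
      also have "\<dots> \<le> (\<Sum>n. \<bar>?y n (tfloor s)\<bar>)"
        by (intro sum_le_suminf abs_summable(1) tfloor_in) auto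
      also have "\<dots> \<le> \<epsilon> * exp (K * (b - a))" by (rule abs_summable(2)[OF tfloor_in])
      finally have "\<bar>k t (tfloor s)\<bar> * \<bar>\<Sum>n<N. ?y n (tfloor s)\<bar> \<le> K * (\<epsilon> * exp (K * (b - a)))"
        using k_bound[OF t tfloor_in] K_nonneg by (intro mult_mono) auto
      then show ?thesis by (simp add: sum_distrib_left[symmetric] abs_mult)
    qed
    show "(\<lambda>N. \<Sum>n<N. k t (tfloor s) * ?y n (tfloor s)) \<longlonglongrightarrow> k t (tfloor s) * neumann r (tfloor s)" for s
      unfolding sum_distrib_left[symmetric] neumann_def
      by (intro tendsto_mult tendsto_const summable_LIMSEQ summable tfloor_in)
  qed (rule integrable_const_ivl)
  moreover have "integral {a..t} (\<lambda>s. \<Sum>n<N. k t (tfloor s) * ?y n (tfloor s)) = (\<Sum>n<N. ?y (Suc n) t)" for N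
    by (subst Henstock_Kurzweil_Integration.integral_sum) (auto simp: int volterra_def step_integral_def)
  moreover have "(\<lambda>N. \<Sum>n<N. ?y (Suc n) t) \<longlonglongrightarrow> neumann r t - r t"
    using summable_LIMSEQ[OF summable_Suc_iff[THEN iffD2, OF summable[OF t]]]
      suminf_split_head[OF summable[OF t]] by (simp add: neumann_def)
  ultimately have "neumann r t - r t = volterra (neumann r) t"
    using LIMSEQ_unique by (simp add: volterra_def step_integral_def)
  then show ?thesis by simp
qed

end

lemma compact_time_scale_ts_interval:
  assumes "time_scale T" "a \<in> T" "b \<in> T" "a < b"
  shows "compact_time_scale (ts_interval T a b) a b"
  using assms by unfold_locales (auto simp: ts_interval_def time_scale_def closed_Int)

theorem theorem1:
  fixes T :: "real set" and a b :: real
    and f :: "real \<Rightarrow> real" and k :: "real \<Rightarrow> real \<Rightarrow> real"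
  assumes "time_scale T" and "a \<in> T" and "b \<in> T" and "a < b"
    and "rd_continuous (ts_interval T a b) f"
    and "rd_continuous2 (ts_interval T a b) k"
  shows "\<exists>C\<ge>0. \<forall>\<epsilon>>0. \<forall>\<psi>. rd_continuous (ts_interval T a b) \<psi> \<longrightarrow>
    (\<forall>t\<in>ts_interval T a b.
       \<bar>\<psi> t - f t - delta_integral (ts_interval T a b) (\<lambda>s. k t s * \<psi> s) a t\<bar> < \<epsilon>) \<longrightarrow>
    (\<exists>\<phi>. rd_continuous (ts_interval T a b) \<phi> \<and>
       (\<forall>t\<in>ts_interval T a b.
          \<phi> t = f t + delta_integral (ts_interval T a b) (\<lambda>s. k t s * \<phi> s) a t) \<and>
       (\<forall>t\<in>ts_interval T a b. \<bar>\<phi> t - \<psi> t\<bar> \<le> C * \<epsilon>))"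
proof -
  define I where "I = ts_interval T a b"
  interpret compact_time_scale I a b
    unfolding I_def using assms by (intro compact_time_scale_ts_interval)
  have f: "rd_continuous I f" and rd_k: "rd_continuous2 I k" using assms by (simp_all add: I_def)
  obtain K where "\<forall>t\<in>I. \<forall>s\<in>I. \<bar>k t s\<bar> \<le> K" using rd_continuous2_bounded[OF rd_k] by blast
  then interpret volterra_kernel I a b k K using rd_k by unfold_locales auto
  show ?thesis
    unfolding I_def[symmetric]
  proof (intro exI[of _ "exp (K * (b - a))"] conjI allI impI)
    fix \<epsilon> :: real and \<psi>
    assume \<psi>: "rd_continuous I \<psi>"
      and res: "\<forall>t\<in>I. \<bar>\<psi> t - f t - delta_integral I (\<lambda>s. k t s * \<psi> s) a t\<bar> < \<epsilon>"
    define r where "r t = \<psi> t - f t - volterra \<psi> t" for t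
    \<comment> \<open>On \<open>I\<close> this equals \<open>\<psi> - neumann r\<close>; the form chosen here is rd-continuous by the smoothing
      property.\<close>
    define \<phi> where "\<phi> t = f t + volterra (\<lambda>s. \<psi> s - neumann r s) t" for t
    have bb: "bounded_borel \<psi>" by (rule rd_continuous_imp_bounded_borel[OF \<psi>])
    have r: "bounded_borel r"
      unfolding r_def
      by (intro bounded_borel_diff bb bounded_borel_volterra rd_continuous_imp_bounded_borel[OF f])
    note e = bounded_borel_neumann[OF r]
    have r_le: "\<bar>r t\<bar> \<le> \<epsilon>" if "t \<in> I" for t
      using res that by (auto simp: r_def volterra_eq_delta_integral[OF \<psi>] intro: less_imp_le)
    have \<phi>_eq: "\<phi> t = \<psi> t - neumann r t" if "t \<in> I" for t
      using neumann_fixpoint[OF r that] volterra_diff[OF bb e that] by (simp add: \<phi>_def r_def)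
    have \<phi>: "rd_continuous I \<phi>"
      unfolding \<phi>_def by (intro rd_continuous_add f rd_continuous_volterra bounded_borel_diff bb e)
    have "\<phi> t = f t + delta_integral I (\<lambda>s. k t s * \<phi> s) a t" if "t \<in> I" for t
      using volterra_cong[of \<phi> "\<lambda>s. \<psi> s - neumann r s" t, OF \<phi>_eq]
      by (simp add: volterra_eq_delta_integral[OF \<phi> that]) (simp add: \<phi>_def)
    moreover have "\<bar>\<phi> t - \<psi> t\<bar> \<le> exp (K * (b - a)) * \<epsilon>" if "t \<in> I" for t
      using neumann_bound[OF r r_le that] \<phi>_eq[OF that] by (simp add: mult.commute)
    ultimately show "\<exists>\<phi>. rd_continuous I \<phi> \<and>
        (\<forall>t\<in>I. \<phi> t = f t + delta_integral I (\<lambda>s. k t s * \<phi> s) a t) \<and>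
        (\<forall>t\<in>I. \<bar>\<phi> t - \<psi> t\<bar> \<le> exp (K * (b - a)) * \<epsilon>)"
      using \<phi> by blast
  qed simp
qed

end
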